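(* Let $P\in\mathbb{Z}[x]$ be a monic polynomial (not necessarily irreducible). Then for every positive integer $n$, $$\sum_{m\mid n}\mu\Big(\frac nm\Big)\Delta(P_m)\equiv 0 \pmod n,$$ where $\mu$ is the Möbius function.
   Context: If $P$ has degree $d$ and roots $\alpha_1,\dots,\alpha_d$ (with multiplicity), then for each integer $n\ge1$, $P_n(x):=\prod_{j=1}^d(x-\alpha_j^n)\in\mathbb{Z}[x]$, and $\Delta(P_n)=\prod_{1\le j<k\le d}(\alpha_j^n-\alpha_k^n)^2$ denotes its discriminant. *)

theory Defs
  imports
    "HOL-Computational_Algebra.Computational_Algebra"
    "HOL-Number_Theory.Cong"
    "HOL-Combinatorics.List_Permutation"
begin

definition moebius_mu :: "nat \<Rightarrow> int" where
  "moebius_mu n = (if squarefree n then (-1) ^ card (prime_factors n) else 0)"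

text \<open>
  The polynomial \<open>P\<^sub>n\<close>: its roots are the \<open>n\<close>-th powers of the complex roots of \<open>P\<close>, counted
  with multiplicity.
\<close>
definition power_roots_poly :: "int poly \<Rightarrow> nat \<Rightarrow> complex poly" where
  "power_roots_poly P n = (\<Prod>\<alpha>\<in>#proots (map_poly of_int P). [:- (\<alpha> ^ n), 1:])"

text \<open>
  The choice of an enumeration of the roots is immaterial; see \<open>discriminant_prod_linear\<close> below.
  The leading coefficient factor is the usual normalisation and is 1 for monic polynomials.
\<close>
definition discriminant :: "complex poly \<Rightarrow> complex" where
  "discriminant p =
     (let xs = (SOME xs. mset xs = proots p) in
      lead_coeff p ^ (2 * degree p - 2) *
      (\<Prod>(j, k) \<in> {(j, k). j < k \<and> k < length xs}. (xs ! j - xs ! k) ^ 2))"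

lemma prod_pairs_cong_mset:
  fixes xs ys :: "complex list"
  assumes "mset xs = mset ys"
  shows "(\<Prod>(j, k) \<in> {(j, k). j < k \<and> k < length xs}. (xs ! j - xs ! k) ^ 2) =
         (\<Prod>(j, k) \<in> {(j, k). j < k \<and> k < length ys}. (ys ! j - ys ! k) ^ 2)"
proof -
  from assms obtain f where f: "f permutes {..<length ys}" and xs: "permute_list f ys = xs"
    using mset_eq_permutation by blast
  have len: "length xs = length ys"
    using xs by auto
  have nth: "xs ! i = ys ! f i" if "i < length ys" for i
    using permute_list_nth[OF f that] xs by simp
  have f_less: "f i < length ys" if "i < length ys" for i
    using permutes_in_image[OF f, of i] that by simp
  define g where "g = inv f"
  have g: "g permutes {..<length ys}"
    unfolding g_def by (rule permutes_inv[OF f])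
  have g_less: "g i < length ys" if "i < length ys" for i
    using permutes_in_image[OF g, of i] that by simp
  have gf: "g (f i) = i" and fg: "f (g i) = i" for i
    unfolding g_def using permutes_inverses[OF f] by auto
  define sw where "sw = (\<lambda>h :: nat \<Rightarrow> nat. \<lambda>(j, k). (min (h j) (h k), max (h j) (h k)))"
  have sw_in: "sw h (j, k) \<in> {(j, k). j < k \<and> k < length ys}"
    if "inj h" "\<And>i. i < length ys \<Longrightarrow> h i < length ys" "j < k" "k < length ys" for h j k
  proof -
    have "h j \<noteq> h k"
      using that(1,3) by (metis injD less_irrefl)
    moreover have "h j < length ys" "h k < length ys"
      using that by auto
    ultimately show ?thesis
      by (auto simp: sw_def min_def max_def)
  qed
  show ?thesis
  proof (rule prod.reindex_bij_witness[where i = "sw g" and j = "sw f"])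
    fix a assume "a \<in> {(j, k). j < k \<and> k < length xs}"
    then obtain j k where a: "a = (j, k)" "j < k" "k < length ys"
      using len by auto
    show "sw g (sw f a) = a"
      using a by (auto simp: sw_def min_def max_def gf)
    show "sw f a \<in> {(j, k). j < k \<and> k < length ys}"
      using a sw_in[of f j k] permutes_inj[OF f] f_less by simp
    show "(case sw f a of (j, k) \<Rightarrow> (ys ! j - ys ! k) ^ 2) =
          (case a of (j, k) \<Rightarrow> (xs ! j - xs ! k) ^ 2)"
      using a by (auto simp: sw_def min_def max_def nth power2_commute)
  next
    fix b assume "b \<in> {(j, k). j < k \<and> k < length ys}"
    then obtain j k where b: "b = (j, k)" "j < k" "k < length ys"
      by auto
    show "sw f (sw g b) = b"
      using b by (auto simp: sw_def min_def max_def fg)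
    show "sw g b \<in> {(j, k). j < k \<and> k < length xs}"
      using b sw_in[of g j k] permutes_inj[OF g] g_less len by simp
  qed
qed

lemma proots_prod_linear:
  fixes \<beta> :: "nat \<Rightarrow> complex"
  shows "proots (\<Prod>j<d. [:- \<beta> j, 1:]) = mset (map \<beta> [0..<d])"
proof (induction d)
  case (Suc d)
  have "(\<Prod>j<d. [:- \<beta> j, 1:]) \<noteq> 0"
    by simp
  then show ?case
    using Suc by (simp add: proots_mult del: mult_pCons_right mult_pCons_left)
qed simp

lemma discriminant_prod_linear:
  fixes \<beta> :: "nat \<Rightarrow> complex"
  shows "discriminant (\<Prod>j<d. [:- \<beta> j, 1:]) =
         (\<Prod>(j, k) \<in> {(j, k). j < k \<and> k < d}. (\<beta> j - \<beta> k) ^ 2)"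
proof -
  define xs where "xs = (SOME xs. mset xs = proots (\<Prod>j<d. [:- \<beta> j, 1:]))"
  have "mset xs = proots (\<Prod>j<d. [:- \<beta> j, 1:])"
    unfolding xs_def by (rule someI_ex) (rule ex_mset)
  then have mset: "mset xs = mset (map \<beta> [0..<d])"
    by (simp only: proots_prod_linear)
  have "lead_coeff (\<Prod>j<d. [:- \<beta> j, 1:]) = 1"
    by (simp add: lead_coeff_prod)
  then have "discriminant (\<Prod>j<d. [:- \<beta> j, 1:]) =
      (\<Prod>(j, k) \<in> {(j, k). j < k \<and> k < length xs}. (xs ! j - xs ! k) ^ 2)"
    by (simp add: discriminant_def Let_def xs_def)
  also have "\<dots> = (\<Prod>(j, k) \<in> {(j, k). j < k \<and> k < d}. (\<beta> j - \<beta> k) ^ 2)"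
    unfolding prod_pairs_cong_mset[OF mset] by (intro prod.cong) auto
  finally show ?thesis .
qed

lemma power_roots_poly_eq:
  fixes P :: "int poly" and \<alpha> :: "nat \<Rightarrow> complex" and d :: nat
  assumes "map_poly of_int P = (\<Prod>j<d. [:- \<alpha> j, 1:])"
  shows "power_roots_poly P n = (\<Prod>j<d. [:- (\<alpha> j ^ n), 1:])"
proof -
  have "power_roots_poly P n = (\<Prod>j\<leftarrow>[0..<d]. [:- (\<alpha> j ^ n), 1:])"
    unfolding power_roots_poly_def assms proots_prod_linear
    by (metis (no_types, lifting) list.map_comp map_eq_conv comp_apply mset_map prod_mset_prod_list)
  also have "\<dots> = (\<Prod>j<d. [:- (\<alpha> j ^ n), 1:])"
    by (simp add: prod.list_conv_set_nth atLeast0LessThan)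
  finally show ?thesis .
qed

lemma discriminant_power_roots_poly:
  fixes P :: "int poly" and \<alpha> :: "nat \<Rightarrow> complex" and d :: nat
  assumes "map_poly of_int P = (\<Prod>j<d. [:- \<alpha> j, 1:])"
  shows "discriminant (power_roots_poly P n) =
         (\<Prod>(j, k) \<in> {(j, k). j < k \<and> k < d}. (\<alpha> j ^ n - \<alpha> k ^ n) ^ 2)"
  unfolding power_roots_poly_eq[OF assms] by (rule discriminant_prod_linear)

end

theory Submission
  imports Defs "Jordan_Normal_Form.Determinant"
begin

text \<open>
  Writing the discriminant as the square of a Vandermonde determinant gives
  \<open>\<Delta>(P\<^sub>n) = det (p\<^bsub>n(i+j)\<^esub>)\<close>, where \<open>p\<^sub>k = \<Sum>\<^sub>j \<alpha>\<^sub>j\<^sup>k\<close>. The integer sequences satisfying the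
  prime-power form of the congruence are closed under sums, products and dilations \<open>n \<mapsto> c n\<close>, so
  it suffices to treat the power sums \<open>p\<^sub>n\<close>. Their generating series is \<open>- X f' / f\<close> for the reversed
  polynomial \<open>f\<close>, which modulo any power of \<open>X\<close> is a product of integer powers of series
  \<open>1 - X\<^sup>k\<close>; each of these contributes an integer multiple of the sequence \<open>n \<mapsto> (if k dvd n then k else 0)\<close>.
\<close>

section \<open>Gauss sequences\<close>

text \<open>The cofactor \<open>m\<close> is arbitrary, possibly \<open>0\<close> or divisible by
  \<open>p\<close>. In this form closure under products is immediate, which it is not for the
  Moebius sum.\<close>

definition gauss_seq :: "(nat \<Rightarrow> int) \<Rightarrow> bool" where
  "gauss_seq a \<longleftrightarrow>
     (\<forall>p r m. prime p \<longrightarrow> [a (p ^ Suc r * m) = a (p ^ r * m)] (mod int (p ^ Suc r)))"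

lemma gauss_seqD:
  "gauss_seq a \<Longrightarrow> prime p \<Longrightarrow> [a (p ^ Suc r * m) = a (p ^ r * m)] (mod int (p ^ Suc r))"
  by (simp add: gauss_seq_def)

lemma gauss_seq_const: "gauss_seq (\<lambda>n. c)"
  by (simp add: gauss_seq_def)

lemma gauss_seq_mult: "gauss_seq a \<Longrightarrow> gauss_seq b \<Longrightarrow> gauss_seq (\<lambda>n. a n * b n)"
  unfolding gauss_seq_def by (blast intro: cong_mult)

lemma gauss_seq_sum: "(\<And>i. i \<in> I \<Longrightarrow> gauss_seq (a i)) \<Longrightarrow> gauss_seq (\<lambda>n. \<Sum>i\<in>I. a i n)"
  unfolding gauss_seq_def by (blast intro: cong_sum)

lemma gauss_seq_prod: "(\<And>i. i \<in> I \<Longrightarrow> gauss_seq (a i)) \<Longrightarrow> gauss_seq (\<lambda>n. \<Prod>i\<in>I. a i n)"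
  unfolding gauss_seq_def by (blast intro: cong_prod)

lemma gauss_seq_dilate:
  assumes "gauss_seq a"
  shows "gauss_seq (\<lambda>n. a (n * c))"
  unfolding gauss_seq_def
proof (intro allI impI)
  fix p r m :: nat
  assume "prime p"
  from gauss_seqD[OF assms this, of r "m * c"]
  show "[a (p ^ Suc r * m * c) = a (p ^ r * m * c)] (mod int (p ^ Suc r))"
    by (simp only: mult.assoc)
qed

text \<open>The two sides differ only if \<open>k\<close> divides \<open>p ^ Suc r * m\<close> but
  not \<open>p ^ r * m\<close>. Then \<open>p ^ Suc r\<close> divides \<open>k\<close>, so the value
  \<open>k\<close> is itself 0 for this modulus.\<close>

lemma gauss_seq_if_dvd: "gauss_seq (\<lambda>n. if n > 0 \<and> k dvd n then int k else 0)"
  unfolding gauss_seq_def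
proof (intro allI impI)
  fix p r m :: nat
  assume p: "prime p"
  show "[if p ^ Suc r * m > 0 \<and> k dvd p ^ Suc r * m then int k else 0 =
         if p ^ r * m > 0 \<and> k dvd p ^ r * m then int k else 0] (mod int (p ^ Suc r))"
  proof (cases "m > 0 \<and> k dvd p ^ Suc r * m \<and> \<not> k dvd p ^ r * m")
    case True
    then have "k \<noteq> 0" using p by (cases "k = 0") auto
    have "p ^ Suc r dvd k"
    proof (rule ccontr)
      assume not_dvd: "\<not> p ^ Suc r dvd k"
      \<comment> \<open>The part \<open>l\<close> of \<open>k\<close> prime to \<open>p\<close>
        divides \<open>m\<close>, so an exponent of \<open>p\<close> in \<open>k\<close> of at most
        \<open>r\<close> would give \<open>k dvd p ^ r * m\<close>.\<close>
      obtain l where l: "k = p ^ multiplicity p k * l" "\<not> p dvd l"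
        using multiplicity_decompose'[of k p] \<open>k \<noteq> 0\<close> p not_prime_unit by blast
      have "multiplicity p k \<le> r"
        using not_dvd multiplicity_dvd'[of "Suc r" p k] by force
      moreover have "l dvd p ^ Suc r * m"
        using True l(1) by (metis dvd_mult_right)
      then have "l dvd m"
        using p l(2) by (metis coprime_dvd_mult_right_iff coprime_commute coprime_power_left_iff prime_imp_coprime)
      ultimately have "k dvd p ^ r * m"
        using l(1) by (metis le_imp_power_dvd mult_dvd_mono)
      with True show False by simp
    qed
    with True show ?thesis
      by (auto simp: cong_0_iff simp del: of_nat_power of_nat_mult)
  next
    case False
    moreover have "k dvd p ^ r * m \<Longrightarrow> k dvd p ^ Suc r * m"
      by (simp add: mult.assoc dvd_mult)
    ultimately show ?thesis
      using p by (auto simp: prime_gt_0_nat)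
  qed
qed

section \<open>From prime-power congruences to the Moebius sum\<close>

lemma moebius_mu_prime_mult:
  assumes "prime p" "\<not> p dvd e"
  shows "moebius_mu (p * e) = - moebius_mu e"
proof (cases "squarefree e")
  case True
  have "e \<noteq> 0" using assms by (metis dvd_0_right)
  have "coprime p e" using assms by (simp add: prime_imp_coprime)
  then have "squarefree (p * e)"
    using squarefree_prime[OF assms(1)] True by (rule squarefree_mult_coprime)
  moreover have "prime_factors (p * e) = insert p (prime_factors e)"
    using assms \<open>e \<noteq> 0\<close> by (simp add: prime_factors_product prime_prime_factors)
  ultimately show ?thesis
    using True assms by (simp add: moebius_mu_def in_prime_factors_iff)
next
  case False
  then show ?thesis
    by (auto simp: moebius_mu_def dest: squarefree_multD)
qed

text \<open>Divisors divisible by \<open>p ^ 2\<close> contribute nothing. The others pair up as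
  \<open>e\<close> and \<open>p * e\<close> with \<open>e dvd q\<close>, carrying opposite Moebius
  signs.\<close>

lemma moebius_sum_prime_power:
  fixes f :: "nat \<Rightarrow> int"
  assumes p: "prime p" and q: "\<not> p dvd q" "q > 0"
  shows "(\<Sum>e | e dvd p ^ Suc r * q. moebius_mu e * f e) =
         (\<Sum>e | e dvd q. moebius_mu e * (f e - f (p * e)))"
proof -
  let ?A = "{e. e dvd q}"
  have fin: "finite ?A" using q by simp
  have not_dvd: "\<not> p dvd e" if "e \<in> ?A" for e
    using that q by auto
  have inj: "inj_on ((*) p) ?A"
    using p by (auto simp: inj_on_def)
  have "(\<Sum>e | e dvd p ^ Suc r * q. moebius_mu e * f e) =
        (\<Sum>e\<in>?A \<union> (*) p ` ?A. moebius_mu e * f e)"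
  proof (rule sum.mono_neutral_right)
    show "finite {e. e dvd p ^ Suc r * q}"
      using p q by (intro finite_divisors_nat) (auto simp: prime_gt_0_nat)
    show "?A \<union> (*) p ` ?A \<subseteq> {e. e dvd p ^ Suc r * q}"
      by (auto simp: mult.assoc intro: mult_dvd_mono dvd_mult)
    show "\<forall>e\<in>{e. e dvd p ^ Suc r * q} - (?A \<union> (*) p ` ?A). moebius_mu e * f e = 0"
    proof
      fix e assume e: "e \<in> {e. e dvd p ^ Suc r * q} - (?A \<union> (*) p ` ?A)"
      have cop: "g dvd q" if "\<not> p dvd g" "g dvd p ^ Suc r * q" for g
        using p that by (metis coprime_dvd_mult_right_iff coprime_commute coprime_power_left_iff prime_imp_coprime)
      \<comment> \<open>A divisor outside both sets is divisible by \<open>p ^ 2\<close>: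
        \<open>cop\<close> is applied first to \<open>e\<close>, then to the cofactor
        \<open>g\<close>.\<close>
      have "p dvd e" using e cop by blast
      then obtain g where g: "e = p * g" by auto
      have "p dvd g"
      proof (rule ccontr)
        assume "\<not> p dvd g"
        moreover have "g dvd p ^ Suc r * q"
          using e g by (metis DiffD1 dvd_mult_right mem_Collect_eq)
        ultimately show False using e g cop by blast
      qed
      then have "p ^ 2 dvd e" by (simp add: g power2_eq_square)
      then have "\<not> squarefree e"
        using p by (intro not_squarefreeI) auto
      then show "moebius_mu e * f e = 0" by (simp add: moebius_mu_def)
    qed
  qed
  also have "\<dots> = (\<Sum>e\<in>?A. moebius_mu e * f e) + (\<Sum>e\<in>(*) p ` ?A. moebius_mu e * f e)"
    using fin not_dvd by (intro sum.union_disjoint) auto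
  also have "(\<Sum>e\<in>(*) p ` ?A. moebius_mu e * f e) = (\<Sum>e\<in>?A. - (moebius_mu e * f (p * e)))"
    using not_dvd p by (simp add: sum.reindex[OF inj] moebius_mu_prime_mult)
  finally show ?thesis
    by (simp add: sum.distrib sum_negf algebra_simps sum_subtractf)
qed

text \<open>Divisibility is checked one prime at a time. After pairing \<open>e\<close> with
  \<open>p * e\<close>, every difference is an instance of the Gauss congruence.\<close>

lemma gauss_seq_moebius_sum_dvd:
  assumes a: "gauss_seq a" and n: "n > 0"
  shows "int n dvd (\<Sum>m | m dvd n. moebius_mu (n div m) * a m)"
proof -
  define s where "s = (\<Sum>m | m dvd n. moebius_mu (n div m) * a m)"
  have s_eq: "s = (\<Sum>e | e dvd n. moebius_mu e * a (n div e))"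
    unfolding s_def using n
    by (intro sum.reindex_bij_witness[where i = "\<lambda>e. n div e" and j = "\<lambda>m. n div m"]) auto
  have prime_power: "p ^ multiplicity p n dvd nat \<bar>s\<bar>" if p: "prime p" for p
  proof (cases "multiplicity p n")
    case (Suc r)
    obtain q where q: "n = p ^ Suc r * q" "\<not> p dvd q"
      using multiplicity_decompose'[of n p] n p Suc not_prime_unit by (metis less_irrefl)
    have "q > 0" using n q by auto
    have "s = (\<Sum>e | e dvd q. moebius_mu e * (a (n div e) - a (n div (p * e))))"
      unfolding s_eq q(1) by (rule moebius_sum_prime_power[OF p q(2) \<open>q > 0\<close>])
    also have "int (p ^ Suc r) dvd \<dots>"
    proof (rule dvd_sum, rule dvd_mult)
      fix e assume "e \<in> {e. e dvd q}"
      then obtain g where g: "q = e * g" by auto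
      have "e > 0" using g \<open>q > 0\<close> by auto
      have "n div e = p ^ Suc r * g"
        using \<open>e > 0\<close> by (simp add: q(1) g mult.left_commute)
      moreover have "n div (p * e) = p ^ r * g"
      proof -
        have "n = (p * e) * (p ^ r * g)" by (simp add: q(1) g ac_simps)
        then show ?thesis using \<open>e > 0\<close> p by (metis nonzero_mult_div_cancel_left mult_eq_0_iff not_prime_0 less_irrefl)
      qed
      ultimately show "int (p ^ Suc r) dvd a (n div e) - a (n div (p * e))"
        using gauss_seqD[OF a p, of r g] by (simp only: cong_iff_dvd_diff)
    qed
    finally show ?thesis by (simp add: Suc nat_dvd_iff dvd_nat_abs_iff)
  qed simp
  have "n dvd nat \<bar>s\<bar>"
  \<comment> \<open>The multiplicity of a prime in 0 is 0 by convention, so this case is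
    separate.\<close>
  proof (cases "s = 0")
    case False
    show ?thesis
    proof (rule multiplicity_le_imp_dvd)
      fix p :: nat assume "prime p"
      from prime_power[OF this] show "multiplicity p n \<le> multiplicity p (nat \<bar>s\<bar>)"
        using False \<open>prime p\<close> by (intro multiplicity_geI) (auto simp: not_prime_unit)
    qed (use n in auto)
  qed simp
  then show ?thesis by (simp add: s_def nat_dvd_iff dvd_nat_abs_iff)
qed

section \<open>Power sums\<close>

text \<open>\<open>S = - X f' / f\<close>, stated without division so that it makes sense over the integers.\<close>
definition log_deriv :: "'a::comm_ring_1 fps \<Rightarrow> 'a fps \<Rightarrow> bool" where
  "log_deriv f S \<longleftrightarrow> f * S = - (fps_X * fps_deriv f)"

lemma log_deriv_1: "log_deriv 1 0"
  by (simp add: log_deriv_def)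

lemma log_deriv_mult: "log_deriv f S \<Longrightarrow> log_deriv g T \<Longrightarrow> log_deriv (f * g) (S + T)"
proof -
  assume "log_deriv f S" "log_deriv g T"
  then have fS: "f * S = - (fps_X * fps_deriv f)" and gT: "g * T = - (fps_X * fps_deriv g)"
    by (simp_all add: log_deriv_def)
  have "f * g * (S + T) = g * (f * S) + f * (g * T)"
    by (simp add: algebra_simps)
  also have "\<dots> = - (fps_X * fps_deriv (f * g))"
    unfolding fS gT by (simp add: algebra_simps)
  finally show ?thesis by (simp add: log_deriv_def)
qed

lemma log_deriv_prod:
  "(\<And>i. i \<in> I \<Longrightarrow> log_deriv (f i) (S i)) \<Longrightarrow> log_deriv (\<Prod>i\<in>I. f i) (\<Sum>i\<in>I. S i)"
  by (induction I rule: infinite_finite_induct) (simp_all add: log_deriv_1 log_deriv_mult)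

lemma log_deriv_unit:
  fixes f :: "'a::comm_ring_1 fps"
  assumes "log_deriv f S" "f * g = 1"
  shows "log_deriv g (- S)"
proof -
  have "f * fps_deriv g + fps_deriv f * g = 0"
    using arg_cong[OF assms(2), of fps_deriv] by simp
  then have deriv: "fps_deriv f * g = - (f * fps_deriv g)"
    by (simp add: eq_neg_iff_add_eq_0 add.commute)
  have "g * (- S) = (f * g) * (g * (- S))"
    by (simp add: assms(2))
  also have "\<dots> = - (g * g * (f * S))"
    by (simp add: ac_simps)
  also have "\<dots> = fps_X * g * (fps_deriv f * g)"
    using assms(1) by (simp add: log_deriv_def ac_simps)
  also have "\<dots> = - ((f * g) * (fps_X * fps_deriv g))"
    unfolding deriv by (simp add: ac_simps)
  finally show ?thesis
    by (simp add: assms(2) log_deriv_def)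
qed

lemma log_deriv_unique:
  fixes f :: "'a::idom fps"
  assumes "log_deriv f S" "log_deriv f T" "f \<noteq> 0"
  shows "S = T"
  using assms unfolding log_deriv_def by (metis mult_left_cancel)

text \<open>This is the geometric expansion of \<open>k X^k / (1 - X^k)\<close>.\<close>

lemma log_deriv_one_minus_X_power:
  assumes "k > 0"
  shows "log_deriv (1 - fps_X ^ k) (Abs_fps (\<lambda>n. if n > 0 \<and> k dvd n then of_nat k else 0))"
  unfolding log_deriv_def
proof (rule fps_ext)
  fix n
  show "fps_nth ((1 - fps_X ^ k) * Abs_fps (\<lambda>n. if n > 0 \<and> k dvd n then of_nat k else 0)) n =
        fps_nth (- (fps_X * fps_deriv (1 - fps_X ^ k :: 'a fps))) n"
    using assms
    by (cases n; cases "n < k")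
       (auto simp: left_diff_distrib fps_X_power_mult_nth fps_X_mult_nth dvd_minus_self
         dest: dvd_imp_le)
qed

lemma one_minus_X_power_inverse:
  assumes "k > 0"
  shows "(1 - fps_X ^ k) * Abs_fps (\<lambda>n. if k dvd n then 1 else 0) = (1 :: 'a::comm_ring_1 fps)"
proof (rule fps_ext)
  fix n
  show "fps_nth ((1 - fps_X ^ k) * Abs_fps (\<lambda>n. if k dvd n then 1 else 0)) n = fps_nth (1 :: 'a fps) n"
    using assms
    by (cases "n < k")
       (auto simp: left_diff_distrib fps_X_power_mult_nth dvd_minus_self dest: dvd_imp_le)
qed

section \<open>Integral series as products of powers of \<open>1 - X^k\<close>\<close>

lemma fps_mult_nth_first:
  fixes f g :: "'a::comm_ring_1 fps"
  assumes "\<And>i. 0 < i \<Longrightarrow> i < k \<Longrightarrow> fps_nth f i = 0" "\<And>i. 0 < i \<Longrightarrow> i < k \<Longrightarrow> fps_nth g i = 0"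
    and "fps_nth f 0 = 1" "fps_nth g 0 = 1" "0 < i" "i \<le> k"
  shows "fps_nth (f * g) i = fps_nth f i + fps_nth g i"
proof -
  have "fps_nth (f * g) i = (\<Sum>j\<in>{0, i}. fps_nth f j * fps_nth g (i - j))"
    unfolding fps_mult_nth using assms by (intro sum.mono_neutral_right) auto
  with assms show ?thesis by simp
qed

lemma gauss_seq_fps_uminus: "gauss_seq (fps_nth S) \<Longrightarrow> gauss_seq (fps_nth (- S))"
  by (simp add: gauss_seq_def cong_minus_minus_iff)

lemma gauss_seq_fps_add:
  "gauss_seq (fps_nth S) \<Longrightarrow> gauss_seq (fps_nth T) \<Longrightarrow> gauss_seq (fps_nth (S + T))"
  by (simp add: gauss_seq_def cong_add)

text \<open>The witness is \<open>(1 - X^k)^(-c)\<close>, built by induction on the integer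
  \<open>c\<close>: for series \<open>1 + O(X^k)\<close>, multiplication adds the coefficients at
  \<open>k\<close>.\<close>

lemma gauss_series_with_leading_coeff:
  assumes "k > 0"
  shows "\<exists>w W. fps_nth w 0 = 1 \<and> (\<forall>i. 0 < i \<longrightarrow> i < k \<longrightarrow> fps_nth w i = 0) \<and> fps_nth w k = (c::int)
    \<and> log_deriv w W \<and> gauss_seq (fps_nth W)"
    (is "\<exists>w W. ?P c w W")
proof -
  define U where "U = Abs_fps (\<lambda>n. if n > 0 \<and> k dvd n then int k else 0)"
  have "fps_nth U = (\<lambda>n. if n > 0 \<and> k dvd n then int k else 0)"
    by (simp add: U_def fun_eq_iff)
  then have U: "gauss_seq (fps_nth U)"
    by (simp only: gauss_seq_if_dvd)
  define Q where "Q = (\<lambda>c w W. ?P c w W)"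
  have minus: "Q (-1) (1 - fps_X ^ k) U"
    using log_deriv_one_minus_X_power[OF assms, where 'a = int, folded U_def] U assms
    by (simp add: Q_def)
  have "log_deriv (Abs_fps (\<lambda>n. if k dvd n then 1 else 0)) (- U)"
    using minus one_minus_X_power_inverse[OF assms] unfolding Q_def by (blast intro: log_deriv_unit)
  then have plus: "Q 1 (Abs_fps (\<lambda>n. if k dvd n then 1 else 0)) (- U)"
    using gauss_seq_fps_uminus[OF U] assms by (auto simp: Q_def dest: dvd_imp_le)
  have mult: "Q (c + c') (w * w') (W + W')" if Q: "Q c w W" "Q c' w' W'" for c c' w w' W W'
  proof -
    have "fps_nth (w * w') i = fps_nth w i + fps_nth w' i" if "0 < i" "i \<le> k" for i
      using Q that by (intro fps_mult_nth_first[of k]) (simp_all add: Q_def)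
    moreover have "fps_nth (w * w') 0 = 1"
      using Q by (simp add: Q_def)
    ultimately show ?thesis
      using Q log_deriv_mult[of w W w' W'] gauss_seq_fps_add[of W W'] assms
      by (simp add: Q_def)
  qed
  have "\<exists>w W. Q c w W"
  proof (induction c rule: int_induct[where k = 0])
    case base
    have "Q 0 1 0"
      using assms by (simp add: Q_def log_deriv_1 gauss_seq_def)
    then show ?case by blast
  next
    case (step1 i)
    then show ?case using mult[OF _ plus] by blast
  next
    case (step2 i)
    then obtain w W where "Q i w W" by blast
    from mult[OF this minus] have "Q (i - 1) (w * (1 - fps_X ^ k)) (W + U)" by simp
    then show ?case by blast
  qed
  then show ?thesis unfolding Q_def .
qed

text \<open>Each congruence involves only two coefficients of \<open>S\<close>, so it is enough that
  \<open>S\<close> agrees with a Gauss sequence up to any prescribed index.\<close>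

lemma log_deriv_gauss_seq:
  fixes f S :: "int fps"
  assumes f: "fps_nth f 0 = 1" and S: "log_deriv f S"
  shows "gauss_seq (fps_nth S)"
proof -
  \<comment> \<open>Multiplying \<open>f\<close> by suitable series kills its coefficients one after the other.\<close>
  have approx: "\<exists>g T. fps_nth g 0 = 1 \<and> (\<forall>i. 0 < i \<longrightarrow> i \<le> k \<longrightarrow> fps_nth g i = 0) \<and> log_deriv g T
      \<and> gauss_seq (fps_nth (S - T))" for k
  proof (induction k)
    case 0
    show ?case
      using f S by (intro exI[of _ f] exI[of _ S]) (simp add: gauss_seq_const)
  next
    case (Suc k)
    then obtain g T where g: "fps_nth g 0 = 1" "\<And>i. 0 < i \<Longrightarrow> i < Suc k \<Longrightarrow> fps_nth g i = 0"
      "log_deriv g T" "gauss_seq (fps_nth (S - T))"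
      by (auto simp only: less_Suc_eq_le)
    obtain w W where w: "fps_nth w 0 = 1" "\<And>i. 0 < i \<Longrightarrow> i < Suc k \<Longrightarrow> fps_nth w i = 0"
      "fps_nth w (Suc k) = - fps_nth g (Suc k)" "log_deriv w W" "gauss_seq (fps_nth W)"
      using gauss_series_with_leading_coeff[of "Suc k" "- fps_nth g (Suc k)"] by auto
    have "fps_nth (g * w) i = 0" if "0 < i" "i \<le> Suc k" for i
      using fps_mult_nth_first[of "Suc k" g w i] g w that by (cases "i = Suc k") auto
    moreover have "gauss_seq (fps_nth (S - (T + W)))"
      using gauss_seq_fps_add[OF g(4) gauss_seq_fps_uminus[OF w(5)]]
      by (simp only: diff_conv_add_uminus minus_add_distrib add.assoc)
    moreover have "fps_nth (g * w) 0 = 1"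
      using g w by simp
    ultimately show ?case
      using log_deriv_mult[OF g(3) w(4)] by blast
  qed
  show ?thesis
    unfolding gauss_seq_def
  proof (intro allI impI)
    fix p r m :: nat assume p: "prime p"
    define N where "N = p ^ Suc r * m"
    obtain g T where g: "fps_nth g 0 = 1" "\<And>i. 0 < i \<Longrightarrow> i \<le> N \<Longrightarrow> fps_nth g i = 0" "log_deriv g T"
      "gauss_seq (fps_nth (S - T))"
      using approx[of N] by auto
    \<comment> \<open>Up to degree \<open>N\<close> the series \<open>g\<close> is 1, so its
      logarithmic derivative \<open>T\<close> vanishes there and \<open>S\<close> agrees with
      \<open>S - T\<close>.\<close>
    have T0: "fps_nth T i = 0" if "i \<le> N" for i
    proof -
      have "fps_nth (g * T) i = (\<Sum>j\<in>{0}. fps_nth g j * fps_nth T (i - j))"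
        unfolding fps_mult_nth using g that by (intro sum.mono_neutral_right) auto
      then have "fps_nth T i = fps_nth (g * T) i" using g by simp
      also have "\<dots> = 0"
        using g that unfolding log_deriv_def by (cases i) (auto simp: fps_X_mult_nth)
      finally show ?thesis .
    qed
    have "p ^ r * m \<le> N"
      using prime_ge_1_nat[OF p] by (simp add: N_def)
    then show "[fps_nth S (p ^ Suc r * m) = fps_nth S (p ^ r * m)] (mod int (p ^ Suc r))"
      using gauss_seqD[OF g(4) p, of r m] T0[of N] T0[of "p ^ r * m"] by (simp add: N_def)
  qed
qed

lemma log_deriv_linear:
  fixes \<alpha> :: "'a::comm_ring_1"
  shows "log_deriv (1 - fps_const \<alpha> * fps_X) (Abs_fps (\<lambda>n. if n = 0 then 0 else \<alpha> ^ n))"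
  unfolding log_deriv_def
proof (rule fps_ext)
  fix n
  show "fps_nth ((1 - fps_const \<alpha> * fps_X) * Abs_fps (\<lambda>n. if n = 0 then 0 else \<alpha> ^ n)) n =
        fps_nth (- (fps_X * fps_deriv (1 - fps_const \<alpha> * fps_X))) n"
    by (cases n; cases "n - 1") (auto simp: left_diff_distrib mult.assoc fps_X_mult_nth)
qed

lemma reflect_poly_linear: "reflect_poly [:a, 1:] = [:1, a :: 'a::comm_semiring_1:]"
  by (rule poly_eqI) (simp add: coeff_reflect_poly coeff_pCons split: nat.split)

text \<open>Since \<open>P\<close> is monic, its reversal has constant term 1 and is invertible over
  the integers, so \<open>S\<close> is integral. Over the complex numbers the reversal is the
  product of the \<open>1 - \<alpha> j X\<close>, which identifies the coefficients of
  \<open>S\<close>.\<close>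

lemma power_sum_gauss_seq:
  fixes P :: "int poly" and \<alpha> :: "nat \<Rightarrow> complex"
  assumes monic: "lead_coeff P = 1" and roots: "map_poly of_int P = (\<Prod>j<d. [:- \<alpha> j, 1:])"
  obtains s where "\<And>n. of_int (s n) = (\<Sum>j<d. \<alpha> j ^ n)" "gauss_seq s"
proof -
  define f where "f = fps_of_poly (reflect_poly P)"
  have f0: "fps_nth f 0 = 1" using monic by (simp add: f_def)
  define S where "S = - (fps_X * fps_deriv f) * fps_right_inverse f 1"
  have inv: "f * fps_right_inverse f 1 = 1"
    using fps_right_inverse[of f 1] f0 by simp
  have S: "log_deriv f S"
    unfolding log_deriv_def S_def using inv by (metis mult.left_commute mult.right_neutral)
  define h :: "int fps \<Rightarrow> complex fps" where "h = (\<lambda>g. Abs_fps (\<lambda>n. of_int (fps_nth g n)))"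
  have h_mult: "h (g * g') = h g * h g'" for g g'
    by (rule fps_ext) (simp add: h_def fps_mult_nth)
  have "h (- (fps_X * fps_deriv f)) = - (fps_X * fps_deriv (h f))"
    by (rule fps_ext) (simp add: h_def fps_X_mult_nth)
  then have hS: "log_deriv (h f) (h S)"
    using S h_mult unfolding log_deriv_def by metis
  have "h f = fps_of_poly (reflect_poly (map_poly of_int P))"
    by (rule fps_ext) (simp add: h_def f_def coeff_reflect_poly coeff_map_poly degree_map_poly)
  also have "\<dots> = (\<Prod>j<d. 1 - fps_const (\<alpha> j) * fps_X)"
    unfolding roots reflect_poly_prod fps_of_poly_prod
    by (intro prod.cong refl) (simp add: reflect_poly_linear fps_of_poly_linear' flip: fps_const_neg)
  finally have "log_deriv (h f) (\<Sum>j<d. Abs_fps (\<lambda>n. if n = 0 then 0 else \<alpha> j ^ n))"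
    by (simp add: log_deriv_prod log_deriv_linear)
  moreover have "h f \<noteq> 0"
    using f0 by (auto simp: h_def fps_eq_iff intro!: exI[of _ 0])
  ultimately have hS_eq: "h S = (\<Sum>j<d. Abs_fps (\<lambda>n. if n = 0 then 0 else \<alpha> j ^ n))"
    using hS log_deriv_unique by blast
  \<comment> \<open>\<open>S\<close> has constant term 0, while the power sum at 0 is
    \<open>d\<close>. The change is harmless: index 0 arises only for \<open>m = 0\<close>, where
    both sides of the congruence coincide.\<close>
  define s where "s = (\<lambda>n. if n = 0 then int d else fps_nth S n)"
  show ?thesis
  proof
    show "of_int (s n) = (\<Sum>j<d. \<alpha> j ^ n)" for n
      using arg_cong[OF hS_eq, of "\<lambda>g. fps_nth g n"] by (simp add: s_def h_def fps_sum_nth)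
    show "gauss_seq s"
      using log_deriv_gauss_seq[OF f0 S] unfolding gauss_seq_def s_def
      by (auto simp: prime_gt_0_nat)
  qed
qed

section \<open>The discriminant as a Hankel determinant\<close>

lemma det_vandermonde:
  fixes x :: "nat \<Rightarrow> 'a::idom"
  shows "det (mat n n (\<lambda>(i, j). x j ^ i)) = (\<Prod>j<n. \<Prod>i<j. x j - x i)"
proof -
  define V where "V = mat n n (\<lambda>(i, j). x j ^ i)"
  \<comment> \<open>Replacing the monomials by the monic polynomials \<open>q i\<close>, which vanish at \<open>x 0, \<dots>, x (i - 1)\<close>,
      is a unitriangular change of basis that makes the matrix triangular.\<close>
  define q where "q = (\<lambda>i. \<Prod>k<i. [:- x k, 1:])"
  define T where "T = mat n n (\<lambda>(i, k). coeff (q i) k)"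
  define M where "M = mat n n (\<lambda>(i, j). \<Prod>k<i. x j - x k)"
  have carrier: "V \<in> carrier_mat n n" "T \<in> carrier_mat n n" "M \<in> carrier_mat n n"
    by (auto simp: V_def T_def M_def)
  have degree: "degree (q i) = i" for i
    unfolding q_def by (subst degree_prod_eq_sum_degree) auto
  have lead: "coeff (q i) i = 1" for i
    using degree[of i] lead_coeff_prod[of "\<lambda>k. [:- x k, 1:]" "{..<i}"] by (simp add: q_def)
  \<comment> \<open>Summing up to \<open>n\<close> instead of the degree makes this an entry of
    \<open>T * V\<close>.\<close>
  have poly_q: "poly (q i) y = (\<Sum>k<n. coeff (q i) k * y ^ k)" if "i < n" for i y
    unfolding poly_altdef degree using that
    by (intro sum.mono_neutral_left) (auto simp: coeff_eq_0 degree)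
  have "T * V = M"
  proof (rule eq_matI)
    fix i j assume "i < dim_row M" "j < dim_col M"
    then have ij: "i < n" "j < n" by (auto simp: M_def)
    then have "(T * V) $$ (i, j) = (\<Sum>k<n. coeff (q i) k * x j ^ k)"
      by (simp add: T_def V_def scalar_prod_def lessThan_atLeast0)
    also have "\<dots> = M $$ (i, j)"
      using ij by (simp add: poly_q[symmetric] M_def) (simp add: q_def poly_prod)
    finally show "(T * V) $$ (i, j) = M $$ (i, j)" .
  qed (simp_all add: T_def V_def M_def)
  then have "det T * det V = det M"
    using det_mult[OF carrier(2,1)] by simp
  moreover have "det T = 1"
  proof -
    have "det T = prod_list (diag_mat T)"
      by (rule det_lower_triangular[OF _ carrier(2)]) (auto simp: T_def coeff_eq_0 degree)
    then show ?thesis by (simp add: prod_list_diag_prod T_def lead)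
  qed
  moreover have "det M = prod_list (diag_mat M)"
  proof (rule det_upper_triangular[OF _ carrier(3)], rule upper_triangularI)
    fix i j assume "j < i" "i < dim_row M"
    then show "M $$ (i, j) = 0"
      by (auto simp: M_def intro!: prod_zero)
  qed
  ultimately show ?thesis
    by (simp add: prod_list_diag_prod V_def M_def lessThan_atLeast0)
qed

text \<open>The Vandermonde matrix times its transpose has power sums as entries, which are integers
  in the application although the roots need not be.\<close>

lemma prod_diff_squares_eq_det_power_sums:
  fixes x :: "nat \<Rightarrow> 'a::idom"
  shows "(\<Prod>(j, k)\<in>{(j, k). j < k \<and> k < d}. (x j - x k) ^ 2) =
         det (mat d d (\<lambda>(i, j). \<Sum>k<d. x k ^ (i + j)))"
proof -
  let ?V = "mat d d (\<lambda>(i, j). x j ^ i)"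
  have "(\<Prod>(j, k)\<in>{(j, k). j < k \<and> k < d}. (x j - x k) ^ 2) =
        (\<Prod>(k, j)\<in>(SIGMA k:{..<d}. {..<k}). (x k - x j) ^ 2)"
    by (rule prod.reindex_bij_witness[where i = prod.swap and j = prod.swap])
       (auto simp: power2_commute)
  also have "\<dots> = (\<Prod>k<d. \<Prod>j<k. (x k - x j) ^ 2)"
    by (rule prod.Sigma[symmetric]) auto
  also have "\<dots> = det ?V ^ 2"
    by (simp only: det_vandermonde prod_power_distrib)
  also have "\<dots> = det ?V * det (transpose_mat ?V)"
    by (subst det_transpose[of _ d]) (auto simp: power2_eq_square)
  also have "\<dots> = det (?V * transpose_mat ?V)"
    by (rule det_mult[symmetric]) auto
  also have "?V * transpose_mat ?V = mat d d (\<lambda>(i, j). \<Sum>k<d. x k ^ (i + j))"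
    by (rule eq_matI) (auto simp: scalar_prod_def lessThan_atLeast0 power_add)
  finally show ?thesis .
qed

section \<open>The congruence for discriminants\<close>

theorem theorem5p1:
  fixes P :: "int poly" and n :: nat
  assumes "lead_coeff P = 1"
    and "n \<ge> 1"
  shows "\<exists>s :: int.
    of_int s = (\<Sum>m | m dvd n. of_int (moebius_mu (n div m)) * discriminant (power_roots_poly P m))
    \<and> [s = 0] (mod int n)"
proof -
  let ?p = "map_poly of_int P :: complex poly"
  have lead: "lead_coeff ?p = 1"
    using assms(1) by (simp add: coeff_map_poly degree_map_poly)
  obtain A where A: "size A = degree ?p" "?p = Polynomial.smult (lead_coeff ?p) (\<Prod>x\<in>#A. [:- x, 1:])"
    using alg_closed_imp_factorization[of ?p] lead by force
  obtain xs where xs: "mset xs = A" using ex_mset by blast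
  define d where "d = length xs"
  define \<alpha> where "\<alpha> = (!) xs"
  have "?p = (\<Prod>x\<leftarrow>xs. [:- x, 1:])"
    using A(2) lead unfolding xs[symmetric] by (simp flip: prod_mset_prod_list mset_map)
  also have "\<dots> = (\<Prod>j<d. [:- \<alpha> j, 1:])"
    by (simp add: prod.list_conv_set_nth d_def \<alpha>_def atLeast0LessThan)
  finally have roots: "?p = (\<Prod>j<d. [:- \<alpha> j, 1:])" .
  obtain s where s: "\<And>n. of_int (s n) = (\<Sum>j<d. \<alpha> j ^ n)" "gauss_seq s"
    using power_sum_gauss_seq[OF assms(1) roots] by blast
  \<comment> \<open>The Leibniz expansion of the Hankel determinant, written over the integers: a
    sum of products of constants and dilations of \<open>s\<close>, to which the closure rules
    apply.\<close>
  define D where "D = (\<lambda>m. \<Sum>\<rho> | \<rho> permutes {0..<d}. sign \<rho> * (\<Prod>i = 0..<d. s (m * (i + \<rho> i))))"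
  have D: "of_int (D m) = discriminant (power_roots_poly P m)" for m
  proof -
    have "discriminant (power_roots_poly P m) =
        det (mat d d (\<lambda>(i, j). \<Sum>k<d. (\<alpha> k ^ m) ^ (i + j)))"
      by (simp only: discriminant_power_roots_poly[OF roots] prod_diff_squares_eq_det_power_sums)
    also have "\<dots> = det (mat d d (\<lambda>(i, j). of_int (s (m * (i + j)))))"
      by (simp add: s(1) power_mult)
    also have "\<dots> = of_int (D m)"
      by (subst det_def'[of _ d]) (auto simp: D_def permutes_in_image intro!: sum.cong prod.cong)
    finally show ?thesis ..
  qed
  have "gauss_seq D"
    unfolding D_def
    by (intro gauss_seq_sum gauss_seq_mult gauss_seq_const gauss_seq_prod gauss_seq_dilate s(2))
  then have "int n dvd (\<Sum>m | m dvd n. moebius_mu (n div m) * D m)"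
    using assms(2) by (intro gauss_seq_moebius_sum_dvd) auto
  then show ?thesis
    by (intro exI[of _ "\<Sum>m | m dvd n. moebius_mu (n div m) * D m"]) (simp add: D cong_0_iff)
qed

end
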